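(* Let $\mathcal I$ be a proper ideal on $\mathbb N$. Then: (1) $\mathfrak{ad}_{\mathsf{Fin}\times\mathcal I}\big((\mathsf{Fin}\times\mathcal I)^+\big)=\mathfrak{ad}_{\mathcal I\times\mathsf{Fin}}\big((\mathcal I\times\mathsf{Fin})^+\big)=2^{\aleph_0}$. In particular, $\mathsf{Fin}\times\mathcal I$ and $\mathcal I\times\mathsf{Fin}$ are not complemented. (2) $(\mathcal I^{\omega})^{\perp}$ is not complemented.
   Context: An ideal on a countable set $X$ is a family of subsets of $X$ containing $\emptyset$ and closed under subsets and finite unions; every ideal is assumed to contain all finite subsets of $X$, and is proper if it is not $\mathcal P(X)$. $\mathsf{Fin}$ is the ideal of finite sets. For an ideal $\mathcal K$ on $X$, $\mathcal K^+=\mathcal P(X)\setminus\mathcal K$; a family $\mathcal B\subseteq\mathcal K^+$ is $\mathcal K$-AD if $A\cap B\in\mathcal K$ for all distinct $A,B\in\mathcal B$; and for $\mathcal A\subseteq\mathcal K^+$, $\mathfrak{ad}_{\mathcal K}(\mathcal A)=\sup\{|\mathcal B|:\mathcal B\subseteq\mathcal A\text{ is a }\mathcal K\text{-AD family}\}$. For ideals $\mathcal I,\mathcal J$ on $\mathbb N$, the Fubini product $\mathcal I\times\mathcal J$ is the ideal on $\mathbb N\times\mathbb N$ given by: $A\in\mathcal I\times\mathcal J$ iff $\{m\in\mathbb N:\{n\in\mathbb N:(m,n)\in A\}\notin\mathcal J\}\in\mathcal I$. $\mathcal I^\omega$ is the ideal on $\mathbb N\times\mathbb N$ of all $A$ such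 that $\{n:(m,n)\in A\}\in\mathcal I$ for every $m\in\mathbb N$. For a family $\mathcal A$ of subsets of a countable set $X$, $\mathcal A^\perp=\{B\subseteq X:B\cap A\text{ is finite for all }A\in\mathcal A\}$. For an ideal $\mathcal K$ on $X$, $\ell_\infty(X)$ is the Banach space of bounded scalar families on $X$ with sup norm and $c_{0,\mathcal K}$ its closed subspace of all $(x_n)_{n\in X}$ with $\{n\in X:|x_n|\ge\varepsilon\}\in\mathcal K$ for every $\varepsilon>0$. $\mathcal K$ is complemented if $c_{0,\mathcal K}$ is the range of a bounded linear projection on $\ell_\infty(X)$. *)

theory Defs
  imports "HOL-Analysis.Analysis"
begin

unbundle cardinal_syntax

section \<open>Ideals\<close>

definition set_ideal :: "'a set set \<Rightarrow> bool" where
  "set_ideal K \<longleftrightarrow>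
     (\<forall>A. finite A \<longrightarrow> A \<in> K) \<and>
     (\<forall>A B. A \<in> K \<and> B \<subseteq> A \<longrightarrow> B \<in> K) \<and>
     (\<forall>A B. A \<in> K \<and> B \<in> K \<longrightarrow> A \<union> B \<in> K)"

definition proper_ideal :: "'a set set \<Rightarrow> bool" where
  "proper_ideal K \<longleftrightarrow> set_ideal K \<and> K \<noteq> UNIV"

definition Fin :: "'a set set" where
  "Fin = {A. finite A}"

definition positive_sets :: "'a set set \<Rightarrow> 'a set set" where
  "positive_sets K = UNIV - K"

definition fubini :: "nat set set \<Rightarrow> nat set set \<Rightarrow> (nat \<times> nat) set set" where
  "fubini I J = {A. {m. {n. (m, n) \<in> A} \<notin> J} \<in> I}"

definition omega_power :: "nat set set \<Rightarrow> (nat \<times> nat) set set" where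
  "omega_power I = {A. \<forall>m. {n. (m, n) \<in> A} \<in> I}"

definition orth :: "'a set set \<Rightarrow> 'a set set" where
  "orth \<A> = {B. \<forall>A\<in>\<A>. finite (B \<inter> A)}"


section \<open>Almost disjoint families\<close>

definition AD_family :: "'a set set \<Rightarrow> 'a set set \<Rightarrow> bool" where
  "AD_family K \<B> \<longleftrightarrow>
     \<B> \<subseteq> positive_sets K \<and> (\<forall>A\<in>\<B>. \<forall>B\<in>\<B>. A \<noteq> B \<longrightarrow> A \<inter> B \<in> K)"

text \<open>
  Cardinals are those of \<^theory>\<open>HOL.BNF_Cardinal_Order_Relation\<close>, i.e. well-orders that
  are minimal on their field, compared by \<open>\<le>o\<close> and identified by \<open>=o\<close>. A supremum is therefore
  determined only up to \<open>=o\<close>. The competing upper bounds \<open>\<mu>\<close> range over cardinals on the same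
  type; below this loses nothing, because all the cardinals considered are bounded by that of
  the whole type.
\<close>

definition is_card_sup :: "'b rel set \<Rightarrow> 'b rel \<Rightarrow> bool" where
  "is_card_sup S \<kappa> \<longleftrightarrow>
     Card_order \<kappa> \<and> (\<forall>r\<in>S. r \<le>o \<kappa>) \<and>
     (\<forall>\<mu> :: 'b rel. Card_order \<mu> \<and> (\<forall>r\<in>S. r \<le>o \<mu>) \<longrightarrow> \<kappa> \<le>o \<mu>)"

definition ad :: "'a set set \<Rightarrow> 'a set set \<Rightarrow> 'a set rel" where
  "ad K \<A> = (SOME \<kappa>. is_card_sup {|\<B>| | \<B>. \<B> \<subseteq> \<A> \<and> AD_family K \<B>} \<kappa>)"

lemma is_card_sup_unique: "is_card_sup S \<kappa> \<Longrightarrow> is_card_sup S \<kappa>' \<Longrightarrow> \<kappa> =o \<kappa>'"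
  by (auto simp: is_card_sup_def ordIso_iff_ordLeq)

lemma is_card_sup_ad: "is_card_sup {|\<B>| | \<B>. \<B> \<subseteq> \<A> \<and> AD_family K \<B>} (ad K \<A>)"
proof -
  let ?S = "{|\<B>| | \<B>. \<B> \<subseteq> \<A> \<and> AD_family K \<B>}"
  let ?U = "{\<mu> :: 'a set rel. Card_order \<mu> \<and> (\<forall>r\<in>?S. r \<le>o \<mu>)}"
  have "|UNIV :: 'a set set| \<in> ?U"
    by (auto simp: card_of_Card_order card_of_mono1)
  then have "?U \<noteq> {}" "\<forall>r\<in>?U. Card_order r"
    by blast+
  then obtain \<kappa> where "\<kappa> \<in> ?U" "\<forall>\<mu>\<in>?U. \<kappa> \<le>o \<mu>"
    using exists_minim_Card_order[of ?U] by blast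
  then have "is_card_sup ?S \<kappa>"
    unfolding is_card_sup_def by blast
  then show ?thesis
    unfolding ad_def by (rule someI)
qed


section \<open>Complemented ideals\<close>

text \<open>
  On a discrete space every function is continuous, so \<open>'a \<Rightarrow>\<^sub>C 'k\<close> is the space of all bounded
  families \<open>'a \<Rightarrow> 'k\<close> with the supremum norm. The scalar field \<open>'k\<close> is a complete real normed
  field, which by Gelfand--Mazur means the real or the complex numbers.
\<close>

instance prod :: (discrete_topology, discrete_topology) discrete_topology
proof
  fix A :: "('a \<times> 'b) set"
  show "open A"
    unfolding open_prod_def
  proof
    fix x assume "x \<in> A"
    then show "\<exists>S T. open S \<and> open T \<and> x \<in> S \<times> T \<and> S \<times> T \<subseteq> A"
      by (intro exI[of _ "{fst x}"] exI[of _ "{snd x}"]) (auto simp: open_discrete)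
  qed
qed

definition scale_bcontfun ::
  "'k \<Rightarrow> ('a :: topological_space \<Rightarrow>\<^sub>C 'k :: real_normed_field) \<Rightarrow> ('a \<Rightarrow>\<^sub>C 'k)" where
  "scale_bcontfun c x = Bcontfun (\<lambda>i. c * apply_bcontfun x i)"

lemma apply_scale_bcontfun: "apply_bcontfun (scale_bcontfun c x) i = c * apply_bcontfun x i"
proof -
  have "(\<lambda>i. c * apply_bcontfun x i) \<in> bcontfun"
  proof (rule bcontfun_normI)
    show "continuous_on UNIV (\<lambda>i. c * apply_bcontfun x i)"
      by (intro continuous_intros) auto
    show "norm (c * apply_bcontfun x i) \<le> norm c * norm x" for i
      by (simp add: norm_mult mult_left_mono norm_bounded)
  qed
  then show ?thesis
    by (simp add: scale_bcontfun_def Bcontfun_inverse)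
qed

lemma vector_space_scale_bcontfun: "vector_space scale_bcontfun"
  by unfold_locales
    (rule bcontfun_eqI, simp add: apply_scale_bcontfun plus_bcontfun.rep_eq algebra_simps)+

definition c0 :: "'a set set \<Rightarrow> ('a :: discrete_topology \<Rightarrow>\<^sub>C 'k :: {real_normed_field, banach}) set" where
  "c0 K = {x. \<forall>\<epsilon>>0. {i. norm (apply_bcontfun x i) \<ge> \<epsilon>} \<in> K}"

text \<open>
  The type argument names the scalar field. Linearity is over \<open>'k\<close>, not merely over the reals
  as in \<^const>\<open>bounded_linear\<close>.
\<close>

definition complemented ::
  "'k :: {real_normed_field, banach} itself \<Rightarrow> 'a :: discrete_topology set set \<Rightarrow> bool" where
  "complemented _ K \<longleftrightarrow>
     (\<exists>P :: ('a \<Rightarrow>\<^sub>C 'k) \<Rightarrow> ('a \<Rightarrow>\<^sub>C 'k).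
        bounded_linear P \<and> Vector_Spaces.linear scale_bcontfun scale_bcontfun P \<and>
        P \<circ> P = P \<and> range P = c0 K)"

end

theory Submission
  imports Defs
begin

text \<open>
  All three ideals contain an almost disjoint family of size continuum among their positive sets,
  and for an ideal \<open>K\<close> on a countable set an uncountable \<open>K\<close>-AD family of positive sets excludes a
  projection onto the space \<open>c0 K\<close>.

  Almost disjoint families. The branches of the binary tree give continuum many infinite subsets of
  \<open>\<nat>\<close> with pairwise finite intersections. Spreading them as \<open>D \<times> \<nat>\<close>, \<open>\<nat> \<times> D\<close> and
  \<open>D \<times> {0}\<close> yields AD families for \<open>Fin \<times> I\<close>, \<open>I \<times> Fin\<close> and the orthogonal of \<open>I\<^sup>\<omega>\<close>
  (lemma \<open>continuum_AD_family\<close>). In the last case \<open>D \<times> {0}\<close> is itself a member of \<open>I\<^sup>\<omega>\<close>, since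
  its vertical sections have at most one point, so it is orthogonal to \<open>I\<^sup>\<omega>\<close> only if finite.

  Excluding projections. Let \<open>P\<close> be a projection onto \<open>c0 K\<close>. Then \<open>x \<mapsto> x - P x\<close> vanishes
  exactly on \<open>c0 K\<close>, and therefore so do, jointly, its countably many coordinate functionals. But a
  single bounded functional vanishing on \<open>c0 K\<close> can be nonzero on only countably many indicators of
  members of a \<open>K\<close>-AD family: modulo \<open>K\<close> these sets are disjoint, so that, just as for the unit
  vectors of a space \<open>c\<^sub>0(\<Gamma>)\<close>, the values on the indicators are absolutely summable
  (lemma \<open>sum_norm_functional_AD_le\<close>). If the AD family is uncountable, some member therefore has
  its indicator in \<open>c0 K\<close>, although the member is not in \<open>K\<close>.
\<close>

section \<open>Ideals, indicators and null families\<close>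

lemma set_ideal_finite: "set_ideal K \<Longrightarrow> finite A \<Longrightarrow> A \<in> K"
  unfolding set_ideal_def by blast

lemma set_ideal_subset: "set_ideal K \<Longrightarrow> A \<in> K \<Longrightarrow> B \<subseteq> A \<Longrightarrow> B \<in> K"
  unfolding set_ideal_def by blast

lemma set_ideal_Un: "set_ideal K \<Longrightarrow> A \<in> K \<Longrightarrow> B \<in> K \<Longrightarrow> A \<union> B \<in> K"
  unfolding set_ideal_def by blast

lemma apply_Bcontfun_discrete:
  fixes f :: "'a :: discrete_topology \<Rightarrow> 'k :: real_normed_vector"
  assumes "\<And>i. norm (f i) \<le> b"
  shows "apply_bcontfun (Bcontfun f) = f"
proof -
  have "continuous_on UNIV f"
    by (simp add: continuous_on_open_invariant open_discrete)
  then show ?thesis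
    using assms by (intro Bcontfun_inverse bcontfun_normI)
qed

definition ind :: "'a set \<Rightarrow> ('a :: discrete_topology \<Rightarrow>\<^sub>C 'k :: real_normed_field)" where
  "ind A = Bcontfun (indicator A)"

lemma apply_ind: "apply_bcontfun (ind A :: 'a :: discrete_topology \<Rightarrow>\<^sub>C 'k :: real_normed_field) = indicator A"
  unfolding ind_def by (rule apply_Bcontfun_discrete[where b = 1]) (simp add: indicator_def)

lemma ind_in_c0_imp_in_ideal:
  assumes "(ind A :: 'a :: discrete_topology \<Rightarrow>\<^sub>C 'k :: {real_normed_field, banach}) \<in> c0 K"
  shows "A \<in> K"
proof -
  have "{i. norm (apply_bcontfun (ind A :: 'a \<Rightarrow>\<^sub>C 'k) i) \<ge> 1} = A"
    by (auto simp: apply_ind indicator_def)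
  then show ?thesis
    using assms by (auto simp: c0_def dest!: spec[of _ "1 :: real"])
qed

lemma supported_in_ideal_imp_c0:
  fixes x :: "'a :: discrete_topology \<Rightarrow>\<^sub>C 'k :: {real_normed_field, banach}"
  assumes K: "set_ideal K" and N: "N \<in> K" and supp: "\<And>i. i \<notin> N \<Longrightarrow> apply_bcontfun x i = 0"
  shows "x \<in> c0 K"
  unfolding c0_def
proof (intro CollectI allI impI)
  fix \<epsilon> :: real assume "\<epsilon> > 0"
  then have "{i. \<epsilon> \<le> norm (apply_bcontfun x i)} \<subseteq> N"
    using supp by (force simp: not_le)
  then show "{i. \<epsilon> \<le> norm (apply_bcontfun x i)} \<in> K"
    using set_ideal_subset[OF K N] by blast
qed

lemma set_ideal_Union:
  assumes "set_ideal K" "finite \<F>" "\<F> \<subseteq> K"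
  shows "\<Union>\<F> \<in> K"
  using assms(2,3) by (induction) (use assms(1) in \<open>auto simp: set_ideal_def\<close>)

lemma AD_family_Int_in: "AD_family K \<B> \<Longrightarrow> A \<in> \<B> \<Longrightarrow> B \<in> \<B> \<Longrightarrow> A \<noteq> B \<Longrightarrow> A \<inter> B \<in> K"
  by (simp add: AD_family_def)

lemma AD_family_notin: "AD_family K \<B> \<Longrightarrow> A \<in> \<B> \<Longrightarrow> A \<notin> K"
  by (simp add: AD_family_def positive_sets_def subset_iff)

section \<open>Functionals vanishing on null families\<close>

text \<open>
  Choose unimodular coefficients that turn every value of \<open>\<phi>\<close> into its norm. The corresponding
  combination of indicators may be large where the sets overlap, but the overlap lies in \<open>K\<close>.
  Erasing it changes the combination by an element of \<open>c0 K\<close>, invisible to \<open>\<phi>\<close>, and leaves a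
  family of norm at most one.
\<close>

lemma sum_norm_functional_AD_le:
  fixes \<phi> :: "('a :: discrete_topology \<Rightarrow>\<^sub>C 'k :: {real_normed_field, banach}) \<Rightarrow> 'k"
  assumes K: "set_ideal K" and AD: "AD_family K \<B>"
    and bl: "bounded_linear \<phi>"
    and homog: "\<And>c x. \<phi> (scale_bcontfun c x) = c * \<phi> x"
    and vanish: "\<And>x. x \<in> c0 K \<Longrightarrow> \<phi> x = 0"
    and S: "finite S" "S \<subseteq> \<B>"
  shows "(\<Sum>A\<in>S. norm (\<phi> (ind A))) \<le> onorm \<phi>"
proof -
  interpret bounded_linear \<phi> by (fact bl)
  \<comment> \<open>If the value is zero, any unimodular number does.\<close>
  define a where
    "a A = (if \<phi> (ind A) = 0 then 1 else of_real (norm (\<phi> (ind A))) / \<phi> (ind A))" for A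
  have norm_a: "norm (a A) = 1" for A
    by (simp add: a_def norm_divide)
  have a_mult: "a A * \<phi> (ind A) = of_real (norm (\<phi> (ind A)))" for A
    by (simp add: a_def)
  define f where "f = (\<Sum>A\<in>S. scale_bcontfun (a A) (ind A))"
  define N where "N = \<Union>{A \<inter> B |A B. A \<in> S \<and> B \<in> S \<and> A \<noteq> B}"
  define g where "g = (\<lambda>i. if i \<in> N then 0 else apply_bcontfun f i)"
  have f_apply: "apply_bcontfun f i = (\<Sum>A\<in>S. a A * indicator A i)" for i
    unfolding f_def using S(1)
    by (induction S) (simp_all add: plus_bcontfun.rep_eq apply_scale_bcontfun apply_ind
        del: sum_mult_indicator)
  have "N \<in> K"
  proof -
    have "{A \<inter> B |A B. A \<in> S \<and> B \<in> S \<and> A \<noteq> B} \<subseteq> (\<lambda>(A, B). A \<inter> B) ` (S \<times> S)"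
      by auto
    then have finite: "finite {A \<inter> B |A B. A \<in> S \<and> B \<in> S \<and> A \<noteq> B}"
      by (rule finite_subset) (intro finite_imageI finite_cartesian_product S(1))
    have "A \<inter> B \<in> K" if "A \<in> S" "B \<in> S" "A \<noteq> B" for A B
      using AD_family_Int_in[OF AD] subsetD[OF S(2)] that by simp
    then have "{A \<inter> B |A B. A \<in> S \<and> B \<in> S \<and> A \<noteq> B} \<subseteq> K"
      by blast
    then show ?thesis
      unfolding N_def by (rule set_ideal_Union[OF K finite])
  qed
  \<comment> \<open>Off the overlap \<open>N\<close>, at most one term of the combination survives.\<close>
  have g_le: "norm (g i) \<le> 1" for i
  proof (cases "i \<notin> N \<and> (\<exists>A\<in>S. i \<in> A)")
    case True
    then obtain A where A: "A \<in> S" "i \<in> A" "i \<notin> N"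
      by blast
    have "a B * indicator B i = (if B = A then a A else 0)" if "B \<in> S" for B
      using that A unfolding N_def by (auto simp: indicator_def)
    then have "g i = (\<Sum>B\<in>S. if B = A then a A else 0)"
      unfolding g_def f_apply using A(3) by simp
    also have "\<dots> = a A"
      using A(1) S(1) by simp
    finally show ?thesis
      by (simp add: norm_a)
  next
    case False
    then have "g i = 0"
      by (auto simp: g_def f_apply indicator_def)
    then show ?thesis by simp
  qed
  have g_apply: "apply_bcontfun (Bcontfun g) = g"
    by (rule apply_Bcontfun_discrete) (rule g_le)
  have "f - Bcontfun g \<in> c0 K"
    by (rule supported_in_ideal_imp_c0[OF K \<open>N \<in> K\<close>], simp add: minus_bcontfun.rep_eq g_apply)
      (simp add: g_def)
  then have "\<phi> f = \<phi> (Bcontfun g)"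
    using vanish[of "f - Bcontfun g"] by (simp add: diff)
  moreover have "\<phi> f = of_real (\<Sum>A\<in>S. norm (\<phi> (ind A)))"
    by (simp add: f_def sum homog a_mult)
  ultimately have "\<phi> (Bcontfun g) = of_real (\<Sum>A\<in>S. norm (\<phi> (ind A)))"
    by (rule trans[OF sym])
  then have "(\<Sum>A\<in>S. norm (\<phi> (ind A))) = norm (\<phi> (Bcontfun g))"
    by (simp only: norm_of_real) (simp add: sum_nonneg)
  also have "\<dots> \<le> onorm \<phi> * norm (Bcontfun g)"
    by (rule onorm[OF bl])
  also have "\<dots> \<le> onorm \<phi> * 1"
    by (intro mult_left_mono norm_bound onorm_pos_le[OF bl]) (simp add: g_apply g_le)
  finally show ?thesis by simp
qed

lemma countable_AD_support_functional:
  fixes \<phi> :: "('a :: discrete_topology \<Rightarrow>\<^sub>C 'k :: {real_normed_field, banach}) \<Rightarrow> 'k"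
  assumes "set_ideal K" "AD_family K \<B>" "bounded_linear \<phi>"
    and "\<And>c x. \<phi> (scale_bcontfun c x) = c * \<phi> x"
    and "\<And>x. x \<in> c0 K \<Longrightarrow> \<phi> x = 0"
  shows "countable {A \<in> \<B>. \<phi> (ind A) \<noteq> 0}"
proof -
  have "(\<lambda>A. norm (\<phi> (ind A))) summable_on \<B>"
    by (rule nonneg_bdd_above_summable_on)
      (auto simp: bdd_above_def intro!: exI[of _ "onorm \<phi>"] sum_norm_functional_AD_le[OF assms])
  from summable_countable_real[OF this] show ?thesis
    by simp
qed

section \<open>Uncountable almost disjoint families exclude projections\<close>

text \<open>
  Countability of the index set bounds the number of coordinate functionals of \<open>x \<mapsto> x - P x\<close>. Each
  of them misses all but countably many indicators of the family, so they all miss a common one.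
\<close>

theorem uncountable_AD_imp_not_complemented:
  fixes K :: "'a :: {discrete_topology, countable} set set"
  assumes K: "set_ideal K" and AD: "AD_family K \<B>" and unc: "uncountable \<B>"
  shows "\<not> complemented TYPE('k :: {real_normed_field, banach}) K"
proof
  assume "complemented TYPE('k) K"
  then obtain P :: "('a \<Rightarrow>\<^sub>C 'k) \<Rightarrow> ('a \<Rightarrow>\<^sub>C 'k)" where
    bl: "bounded_linear P" and lin: "Vector_Spaces.linear scale_bcontfun scale_bcontfun P"
    and PP: "P \<circ> P = P" and range: "range P = c0 K"
    unfolding complemented_def by blast
  have fixed: "x \<in> c0 K \<longleftrightarrow> P x = x" for x
    using PP range by (metis comp_apply rangeE rangeI)
  define \<phi> where "\<phi> i x = apply_bcontfun (x - P x) i" for i x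
  have bl_\<phi>: "bounded_linear (\<phi> i)" for i
  proof -
    have "bounded_linear (\<lambda>x :: 'a \<Rightarrow>\<^sub>C 'k. apply_bcontfun x i)"
      by (rule bounded_linear_intro[where K = 1])
        (simp_all add: plus_bcontfun.rep_eq scaleR_bcontfun.rep_eq norm_bounded)
    moreover have "bounded_linear (\<lambda>x. x - P x)"
      using bl by (intro bounded_linear_sub bounded_linear_ident)
    ultimately show ?thesis
      unfolding \<phi>_def by (rule bounded_linear_compose)
  qed
  have scale_\<phi>: "\<phi> i (scale_bcontfun c x) = c * \<phi> i x" for i c x
    by (simp add: \<phi>_def minus_bcontfun.rep_eq apply_scale_bcontfun algebra_simps
        module_hom.scale[OF Vector_Spaces.linear.axioms(3)[OF lin]])
  have "countable (\<Union>i. {A \<in> \<B>. \<phi> i (ind A) \<noteq> 0})"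
    by (intro countable_UN countableI_type countable_AD_support_functional[OF K AD bl_\<phi> scale_\<phi>])
      (auto simp: \<phi>_def fixed)
  then have "\<not> \<B> \<subseteq> (\<Union>i. {A \<in> \<B>. \<phi> i (ind A) \<noteq> 0})"
    using unc countable_subset by blast
  then obtain A where A: "A \<in> \<B>" and "\<And>i. \<phi> i (ind A) = 0"
    by blast
  then have "(ind A :: 'a \<Rightarrow>\<^sub>C 'k) \<in> c0 K"
    unfolding fixed by (intro bcontfun_eqI) (simp add: \<phi>_def minus_bcontfun.rep_eq)
  then have "A \<in> K"
    by (rule ind_in_c0_imp_in_ideal)
  then show False
    using AD_family_notin[OF AD A] by simp
qed

section \<open>Almost disjoint families of size continuum\<close>

text \<open>
  The set \<open>S\<close> is read as a branch of the binary tree, whose node at level \<open>n\<close> is the code of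
  \<open>S \<inter> {0..<n}\<close>. Tagging the node with its level keeps the branch infinite even if \<open>S\<close> is finite.
\<close>

definition branch :: "nat set \<Rightarrow> nat set" where
  "branch S = range (\<lambda>n. prod_encode (n, set_encode (S \<inter> {..<n})))"

lemma infinite_branch: "infinite (branch S)"
  unfolding branch_def by (rule range_inj_infinite) (simp add: inj_def)

lemma finite_branch_Int:
  assumes "S \<noteq> T"
  shows "finite (branch S \<inter> branch T)"
proof -
  obtain k where k: "(k \<in> S) \<noteq> (k \<in> T)"
    using assms by blast
  have "branch S \<inter> branch T \<subseteq> (\<lambda>n. prod_encode (n, set_encode (S \<inter> {..<n}))) ` {..k}"
  proof
    fix x assume "x \<in> branch S \<inter> branch T"
    then obtain n where n: "x = prod_encode (n, set_encode (S \<inter> {..<n}))"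
      and "set_encode (S \<inter> {..<n}) = set_encode (T \<inter> {..<n})"
      by (auto simp: branch_def)
    then have "S \<inter> {..<n} = T \<inter> {..<n}"
      by (simp add: set_encode_eq)
    then have "n \<le> k"
      using k by (metis IntD1 IntI lessThan_iff not_le)
    then show "x \<in> (\<lambda>n. prod_encode (n, set_encode (S \<inter> {..<n}))) ` {..k}"
      using n by blast
  qed
  then show ?thesis
    by (rule finite_subset) simp
qed

lemma continuum_AD_family:
  assumes pos: "\<And>D :: nat set. infinite D \<Longrightarrow> F D \<notin> K"
    and disj: "\<And>D E. finite (D \<inter> E) \<Longrightarrow> F D \<inter> F E \<in> K"
  obtains g :: "nat set \<Rightarrow> 'a set" where "inj g" "AD_family K (range g)"
proof
  let ?g = "\<lambda>S. F (branch S)"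
  show "inj ?g"
  proof (rule injI, rule ccontr)
    fix S T assume "F (branch S) = F (branch T)" "S \<noteq> T"
    then show False
      using disj[OF finite_branch_Int] pos[OF infinite_branch] by (metis inf.idem)
  qed
  show "AD_family K (range ?g)"
    unfolding AD_family_def
  proof (intro conjI ballI impI)
    show "range ?g \<subseteq> positive_sets K"
      by (auto simp: positive_sets_def pos[OF infinite_branch])
    fix A B assume "A \<in> range ?g" "B \<in> range ?g" "A \<noteq> B"
    then obtain S T where "A = ?g S" "B = ?g T" "S \<noteq> T"
      by blast
    then show "A \<inter> B \<in> K"
      by (simp add: disj finite_branch_Int)
  qed
qed

lemma uncountable_UNIV_nat_set: "uncountable (UNIV :: nat set set)"
  using Cantors_theorem[of "UNIV :: nat set"] by (auto simp: uncountable_def)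

lemma continuum_eq_card_nat_set: "|UNIV :: nat set set| =o ctwo ^c natLeq"
proof -
  have "|Pow (Field natLeq)| =o ctwo ^c natLeq"
    unfolding ctwo_def cexp_def Field_card_of by (rule card_of_Pow_Func)
  then show ?thesis
    by (simp add: Field_natLeq)
qed

text \<open>
  The upper bound holds because a countable set has only continuum many subsets at all.
\<close>

lemma ad_positive_sets_eq_continuum:
  fixes K :: "'a :: countable set set" and g :: "nat set \<Rightarrow> 'a set"
  assumes "inj g" "AD_family K (range g)"
  shows "ad K (positive_sets K) =o ctwo ^c natLeq"
proof -
  let ?S = "{|\<B>| | \<B>. \<B> \<subseteq> positive_sets K \<and> AD_family K \<B>}"
  have sup: "is_card_sup ?S (ad K (positive_sets K))"
    by (rule is_card_sup_ad)
  have "|UNIV :: nat set set| \<le>o |range g|"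
    using assms(1) card_of_ordLeq[of "UNIV :: nat set set" "range g"] by auto
  moreover have "|range g| \<le>o ad K (positive_sets K)"
  proof -
    have "range g \<subseteq> positive_sets K"
      using assms(2) by (simp add: AD_family_def)
    then have "|range g| \<in> ?S"
      using assms(2) by blast
    then show ?thesis
      using sup unfolding is_card_sup_def by blast
  qed
  ultimately have lower: "|UNIV :: nat set set| \<le>o ad K (positive_sets K)"
    by (rule ordLeq_transitive)
  have "inj (\<lambda>A :: 'a set. to_nat ` A)"
    by (simp add: inj_def inj_image_eq_iff)
  then have "|UNIV :: 'a set set| \<le>o |UNIV :: nat set set|"
    using card_of_ordLeq[of "UNIV :: 'a set set" "UNIV :: nat set set"] by auto
  moreover have "ad K (positive_sets K) \<le>o |UNIV :: 'a set set|"
    using sup card_of_Card_order[of "UNIV :: 'a set set"] card_of_mono1[OF subset_UNIV]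
    unfolding is_card_sup_def by blast
  ultimately have upper: "ad K (positive_sets K) \<le>o |UNIV :: nat set set|"
    using ordLeq_transitive by blast
  show ?thesis
    using lower upper continuum_eq_card_nat_set by (meson ordIso_iff_ordLeq ordIso_transitive)
qed

section \<open>The product ideals and the orthogonal\<close>

lemma set_ideal_Fin: "set_ideal Fin"
  by (auto simp: set_ideal_def Fin_def intro: finite_subset)

lemma set_ideal_fubini:
  assumes I: "set_ideal I" and J: "set_ideal J"
  shows "set_ideal (fubini I J)"
  unfolding set_ideal_def
proof (intro conjI allI impI; (elim conjE)?)
  fix A :: "(nat \<times> nat) set" assume "finite A"
  have "{n. (m, n) \<in> A} \<subseteq> snd ` A" for m
    by force
  then have "{n. (m, n) \<in> A} \<in> J" for m
    using J \<open>finite A\<close> unfolding set_ideal_def by (meson finite_imageI finite_subset)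
  then show "A \<in> fubini I J"
    using I by (simp add: fubini_def set_ideal_def)
next
  fix A B :: "(nat \<times> nat) set" assume A: "A \<in> fubini I J" and "B \<subseteq> A"
  then have "{n. (m, n) \<in> B} \<subseteq> {n. (m, n) \<in> A}" for m
    by blast
  then have "{m. {n. (m, n) \<in> B} \<notin> J} \<subseteq> {m. {n. (m, n) \<in> A} \<notin> J}"
    using set_ideal_subset[OF J] by blast
  then show "B \<in> fubini I J"
    using set_ideal_subset[OF I] A unfolding fubini_def by blast
next
  fix A B :: "(nat \<times> nat) set" assume A: "A \<in> fubini I J" and B: "B \<in> fubini I J"
  have "{n. (m, n) \<in> A \<union> B} = {n. (m, n) \<in> A} \<union> {n. (m, n) \<in> B}" for m
    by blast
  then have "{m. {n. (m, n) \<in> A \<union> B} \<notin> J} \<subseteq>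
      {m. {n. (m, n) \<in> A} \<notin> J} \<union> {m. {n. (m, n) \<in> B} \<notin> J}"
    using set_ideal_Un[OF J] by auto
  moreover have "{m. {n. (m, n) \<in> A} \<notin> J} \<union> {m. {n. (m, n) \<in> B} \<notin> J} \<in> I"
    using set_ideal_Un[OF I] A B unfolding fubini_def by blast
  ultimately show "A \<union> B \<in> fubini I J"
    using set_ideal_subset[OF I] unfolding fubini_def by blast
qed

lemma set_ideal_orth: "set_ideal (orth \<A>)"
  unfolding set_ideal_def orth_def
  by (auto simp: Int_Un_distrib2 intro: finite_subset[OF Int_mono])

lemma proper_ideal_UNIV_notin:
  assumes "proper_ideal K"
  shows "UNIV \<notin> K"
  using assms set_ideal_subset[of K UNIV] unfolding proper_ideal_def by blast

lemma AD_family_fubini_Fin_left: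
  assumes "proper_ideal I"
  obtains g :: "nat set \<Rightarrow> (nat \<times> nat) set" where "inj g" "AD_family (fubini Fin I) (range g)"
proof (rule continuum_AD_family[of "\<lambda>D. D \<times> UNIV" "fubini Fin I"])
  have "{} \<in> I"
    using assms by (simp add: proper_ideal_def set_ideal_def)
  then have "{m. {n. (m, n) \<in> D \<times> UNIV} \<notin> I} = D" for D :: "nat set"
    using proper_ideal_UNIV_notin[OF assms] by auto
  then have iff: "D \<times> UNIV \<in> fubini Fin I \<longleftrightarrow> finite D" for D
    by (simp only: fubini_def Fin_def mem_Collect_eq)
  show "D \<times> UNIV \<notin> fubini Fin I" if "infinite D" for D
    using that iff by blast
  show "(D \<times> UNIV) \<inter> (E \<times> UNIV) \<in> fubini Fin I" if "finite (D \<inter> E)" for D E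
    using that iff[of "D \<inter> E"] by (simp add: Times_Int_Times)
qed (rule that)

lemma AD_family_fubini_Fin_right:
  assumes "proper_ideal I"
  obtains g :: "nat set \<Rightarrow> (nat \<times> nat) set" where "inj g" "AD_family (fubini I Fin) (range g)"
proof (rule continuum_AD_family[of "\<lambda>D. UNIV \<times> D" "fubini I Fin"])
  have "{} \<in> I"
    using assms by (simp add: proper_ideal_def set_ideal_def)
  then have iff: "UNIV \<times> D \<in> fubini I Fin \<longleftrightarrow> finite D" for D
    using proper_ideal_UNIV_notin[OF assms] by (simp add: fubini_def Fin_def)
  show "UNIV \<times> D \<notin> fubini I Fin" if "infinite D" for D
    using that iff by blast
  show "(UNIV \<times> D) \<inter> (UNIV \<times> E) \<in> fubini I Fin" if "finite (D \<inter> E)" for D E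
    using that iff[of "D \<inter> E"] by (simp add: Times_Int_Times)
qed (rule that)

lemma AD_family_orth_omega_power:
  assumes "set_ideal I"
  obtains g :: "nat set \<Rightarrow> (nat \<times> nat) set" where "inj g" "AD_family (orth (omega_power I)) (range g)"
proof (rule continuum_AD_family[of "\<lambda>D. D \<times> {0}" "orth (omega_power I)"])
  show "D \<times> {0} \<notin> orth (omega_power I)" if "infinite D" for D :: "nat set"
  proof
    assume orth: "D \<times> {0} \<in> orth (omega_power I)"
    have "D \<times> {0} \<in> omega_power I"
      unfolding omega_power_def mem_Collect_eq
    proof
      show "{n. (m, n) \<in> D \<times> {0}} \<in> I" for m
        by (rule set_ideal_finite[OF assms], rule finite_subset[of _ "{0}"]) auto
    qed
    then have "finite (D \<times> {0 :: nat})"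
      using orth unfolding orth_def by fastforce
    then show False
      using that by (auto dest: finite_cartesian_productD1)
  qed
  show "(D \<times> {0}) \<inter> (E \<times> {0}) \<in> orth (omega_power I)" if "finite (D \<inter> E)" for D E :: "nat set"
    using that by (simp add: Times_Int_Times orth_def)
qed (rule that)

theorem theorem7p10:
  fixes I :: "nat set set"
  assumes "proper_ideal I"
  shows "(ad (fubini Fin I) (positive_sets (fubini Fin I)) =o ctwo ^c natLeq \<and>
          ad (fubini I Fin) (positive_sets (fubini I Fin)) =o ctwo ^c natLeq \<and>
          \<not> complemented TYPE('k :: {real_normed_field, banach}) (fubini Fin I) \<and>
          \<not> complemented TYPE('k) (fubini I Fin)) \<and>
         \<not> complemented TYPE('k) (orth (omega_power I))"
proof -
  have I: "set_ideal I"
    using assms by (simp add: proper_ideal_def)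
  have uncountable_range: "uncountable (range g)" if "inj g" for g :: "nat set \<Rightarrow> (nat \<times> nat) set"
    using countable_image_inj_on[OF _ that] uncountable_UNIV_nat_set by (rule contrapos_nn[rotated])
  obtain g1 :: "nat set \<Rightarrow> (nat \<times> nat) set"
    where g1: "inj g1" "AD_family (fubini Fin I) (range g1)"
    using AD_family_fubini_Fin_left[OF assms] by blast
  obtain g2 :: "nat set \<Rightarrow> (nat \<times> nat) set"
    where g2: "inj g2" "AD_family (fubini I Fin) (range g2)"
    using AD_family_fubini_Fin_right[OF assms] by blast
  obtain g3 :: "nat set \<Rightarrow> (nat \<times> nat) set"
    where g3: "inj g3" "AD_family (orth (omega_power I)) (range g3)"
    using AD_family_orth_omega_power[OF I] by blast
  show ?thesis
    by (intro conjI ad_positive_sets_eq_continuum[OF g1] ad_positive_sets_eq_continuum[OF g2]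
      uncountable_AD_imp_not_complemented[OF set_ideal_fubini[OF set_ideal_Fin I] g1(2)]
      uncountable_AD_imp_not_complemented[OF set_ideal_fubini[OF I set_ideal_Fin] g2(2)]
      uncountable_AD_imp_not_complemented[OF set_ideal_orth g3(2)]
      uncountable_range g1(1) g2(1) g3(1))
qed

end
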